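(* Let $h = \chi_{\{0\} \times \mathbb{Q}} : [0,1] \times \mathbb{R} \to \mathbb{R}$ be the characteristic function of $\{0\} \times \mathbb{Q}$. Then the superposition operator $S_h$ maps $\mathcal{B}_1([0,1])$ into itself, i.e. for every $g \in \mathcal{B}_1([0,1])$ the function $t \mapsto h(t,g(t))$ belongs to $\mathcal{B}_1([0,1])$, but $h$ is not of Baire class one on $[0,1]\times\mathbb{R}$ (in particular, $h$ is not continuous).
   Context: For a Polish space $X$, a function $g: X \to \mathbb{R}$ is of Baire class one if it is the pointwise limit on $X$ of a sequence of continuous functions $X \to \mathbb{R}$; $\mathcal{B}_1(X)$ denotes the set of all such functions. For $h:[0,1]\times\mathbb{R}\to\mathbb{R}$, the superposition operator $S_h$ sends $g:[0,1]\to\mathbb{R}$ to the function $S_h(g)(t) = h(t,g(t))$, $t \in [0,1]$. *)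

theory Defs
  imports "HOL-Analysis.Analysis"
begin

(* A function on X is represented by a total function whose values outside X are irrelevant.
   X carries the subspace topology; the Polish space X of interest is a subset of the ambient type. *)
definition baire_one_functions :: "'a::topological_space set \<Rightarrow> ('a \<Rightarrow> real) set" where
  "baire_one_functions X =
     {g. \<exists>f :: nat \<Rightarrow> 'a \<Rightarrow> real.
           (\<forall>n. continuous_on X (f n)) \<and> (\<forall>x\<in>X. (\<lambda>n. f n x) \<longlonglongrightarrow> g x)}"

definition superposition :: "(real \<times> real \<Rightarrow> real) \<Rightarrow> (real \<Rightarrow> real) \<Rightarrow> real \<Rightarrow> real" where
  "superposition h g = (\<lambda>t. h (t, g t))"

end

theory Submission
  imports Defs
begin

text \<open>For a fixed \<open>g\<close> the superposition only sees \<open>g 0\<close>: it is a multiple of the indicator of a point,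
  a pointwise limit of tent functions. If \<open>h\<close> were of Baire class one, so would be its restriction
  to \<open>{0} \<times> \<real>\<close>, i.e. the Dirichlet function, and \<open>\<rat>\<close> would then be a dense \<open>G\<close>-delta set, contradicting
  the Baire category theorem.\<close>

lemma continuous_imp_baire_one:
  "continuous_on X g \<Longrightarrow> g \<in> baire_one_functions X"
  unfolding baire_one_functions_def by (auto intro!: exI[of _ "\<lambda>_. g"])

text \<open>Composing each approximant with \<open>p\<close> preserves continuity and pointwise
  convergence. The intended \<open>p\<close> embeds a line as a slice of the product.\<close>

lemma baire_one_compose:
  assumes "g \<in> baire_one_functions Y" "continuous_on X p" "p ` X \<subseteq> Y"
  shows "(\<lambda>x. g (p x)) \<in> baire_one_functions X"
proof -
  obtain f where f: "\<And>n. continuous_on Y (f n)" "\<And>y. y \<in> Y \<Longrightarrow> (\<lambda>n. f n y) \<longlonglongrightarrow> g y"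
    using assms(1) unfolding baire_one_functions_def by blast
  have "continuous_on X (\<lambda>x. f n (p x))" for n
    using continuous_on_compose2[OF f(1) assms(2,3)] .
  moreover have "(\<lambda>n. f n (p x)) \<longlonglongrightarrow> g (p x)" if "x \<in> X" for x
    using f(2) assms(3) that by blast
  ultimately show ?thesis
    unfolding baire_one_functions_def
    by (intro CollectI exI[of _ "\<lambda>n x. f n (p x)"]) auto
qed

text \<open>The factor \<open>c\<close> will be 1 or 0 according to whether \<open>g 0\<close> is
  rational, so both cases are covered at once.\<close>

lemma scaled_point_indicator_baire_one:
  fixes a c :: real
  shows "(\<lambda>t. c * indicator {a} t) \<in> baire_one_functions X"
proof -
  \<comment> \<open>Tents with value \<open>c\<close> at \<open>a\<close> that vanish once the
    distance to \<open>a\<close> is at least \<open>1/n\<close>, for positive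
    \<open>n\<close>.\<close>
  define f where "f n t = c * max 0 (1 - real n * \<bar>t - a\<bar>)" for n t
  have "continuous_on X (f n)" for n
    unfolding f_def by (intro continuous_intros)
  moreover have "(\<lambda>n. f n t) \<longlonglongrightarrow> c * indicator {a} t" for t
  proof (cases "t = a")
    case True
    then show ?thesis by (simp add: f_def)
  next
    case False
    then obtain N where N: "1 < real N * \<bar>t - a\<bar>"
      using reals_Archimedean3[of "\<bar>t - a\<bar>"] by auto
    have "f n t = 0" if "n \<ge> N" for n
    proof -
      have "real N * \<bar>t - a\<bar> \<le> real n * \<bar>t - a\<bar>"
        using that by (intro mult_right_mono) auto
      then show ?thesis using N by (simp add: f_def)
    qed
    then have "(\<lambda>n. f n t) \<longlonglongrightarrow> 0"
      by (intro tendsto_eventually) (auto simp: eventually_sequentially)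
    then show ?thesis using False by simp
  qed
  ultimately show ?thesis
    unfolding baire_one_functions_def by blast
qed

lemma indicator_Rats_not_baire_one:
  "(indicator \<rat> :: real \<Rightarrow> real) \<notin> baire_one_functions UNIV"
proof
  assume "(indicator \<rat> :: real \<Rightarrow> real) \<in> baire_one_functions UNIV"
  then obtain f :: "nat \<Rightarrow> real \<Rightarrow> real" where cont: "\<And>n. continuous_on UNIV (f n)"
    and lim: "\<And>y. (\<lambda>n. f n y) \<longlonglongrightarrow> indicator \<rat> y"
    unfolding baire_one_functions_def by auto
  \<comment> \<open>The threshold 1/2 separates the limits 1 and 0: a rational lies in every
    \<open>U N\<close>, an irrational is missed by some \<open>U N\<close>. Hence the
    \<open>U N\<close> intersect exactly in \<open>\<rat>\<close>.\<close>
  define U where "U N = (\<Union>n\<in>{N..}. {y. 1/2 < f n y})" for N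
  \<comment> \<open>Countability of \<open>\<rat>\<close> allows removing every rational point while
    keeping the family countable, which leaves an empty intersection.\<close>
  define G where "G = range U \<union> (\<lambda>q. - {q}) ` \<rat>"
  have openU: "open (U N)" for N
    unfolding U_def by (intro open_UN ballI open_Collect_less cont continuous_on_const)
  have "\<rat> \<subseteq> U N" for N
  proof
    fix y :: real assume "y \<in> \<rat>"
    then have "\<forall>\<^sub>F n in sequentially. 1/2 < f n y"
      using order_tendstoD(1)[OF lim, of "1/2" y] by simp
    then obtain M where "\<And>n. n \<ge> M \<Longrightarrow> 1/2 < f n y"
      by (auto simp: eventually_sequentially)
    then have "1/2 < f (max M N) y" by simp
    then show "y \<in> U N" unfolding U_def by (intro UN_I[of "max M N"]) auto
  qed
  then have "closure (U N) = UNIV" for N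
    using closure_mono[of "\<rat>" "U N"] Rats_closure_real by auto
  \<comment> \<open>A single point of the line has empty interior.\<close>
  moreover have "closure (- {q}) = UNIV" for q :: real
    by (simp add: closure_complement)
  ultimately have "UNIV \<subseteq> closure (\<Inter>G)"
    using openU by (intro Baire) (auto simp: G_def countable_rat)
  moreover have "\<Inter>G = {}"
  proof -
    have "y \<notin> \<Inter>G" for y
    proof (cases "y \<in> \<rat>")
      case True
      then show ?thesis by (auto simp: G_def)
    next
      case False
      then have "\<forall>\<^sub>F n in sequentially. f n y < 1/2"
        using order_tendstoD(2)[OF lim, of y "1/2"] by simp
      then obtain N where "\<And>n. n \<ge> N \<Longrightarrow> f n y < 1/2"
        by (auto simp: eventually_sequentially)
      then have "y \<notin> U N" by (force simp: U_def)
      then show ?thesis by (auto simp: G_def)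
    qed
    then show ?thesis by blast
  qed
  ultimately show False by simp
qed

theorem mainTheorem3:
  fixes h :: "real \<times> real \<Rightarrow> real"
  assumes "h = indicator ({0} \<times> \<rat>)"
  shows "(\<forall>g \<in> baire_one_functions {0..1}. superposition h g \<in> baire_one_functions {0..1})
    \<and> h \<notin> baire_one_functions ({0..1} \<times> UNIV)
    \<and> \<not> continuous_on ({0..1} \<times> UNIV) h"
proof -
  \<comment> \<open>\<open>h\<close> vanishes off the slice over 0, so \<open>g\<close> enters only
    through the constant \<open>g 0\<close>.\<close>
  have "superposition h g = (\<lambda>t. indicator \<rat> (g 0) * indicator {0} t)" for g
    by (auto simp: superposition_def assms indicator_def)
  then have "superposition h g \<in> baire_one_functions {0..1}" for g
    by (simp only: scaled_point_indicator_baire_one)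
  moreover have not_baire: "h \<notin> baire_one_functions ({0..1} \<times> UNIV)"
  proof
    assume "h \<in> baire_one_functions ({0..1} \<times> UNIV)"
    then have "(\<lambda>y. h (0, y)) \<in> baire_one_functions UNIV"
      \<comment> \<open>Here \<open>p\<close> is the embedding of the line as the slice over
        0.\<close>
      by (rule baire_one_compose) (auto intro!: continuous_intros)
    moreover have "(\<lambda>y. h (0, y)) = indicator \<rat>"
      by (auto simp: assms indicator_def)
    ultimately show False using indicator_Rats_not_baire_one by simp
  qed
  \<comment> \<open>Discontinuity follows by contraposition: a continuous \<open>h\<close> would be
    of Baire class one.\<close>
  ultimately show ?thesis using continuous_imp_baire_one by blast
qed

end
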